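(* Let $G$ be a group of order $2^m$ of rank $5$ belonging to the isoclinism family $\Gamma_7$. Then (1) $\displaystyle A_G(t/|G|)=\frac{1-2^{-2}}{1-2^{-2}t} + \frac{2^{-2}-2^{-4}}{1-2^{-1}t} + \frac{2^{-4}}{1-t}$; (2) $\displaystyle B_G(t/|G|)=\frac{-2^{-1}-2^{-2}}{1-2^{-3}t} + \frac{1+2^{-1}+2^{-2}}{1-2^{-2}t}$.
   Context: For a finite group $G$ and $n\ge 0$, $\alpha_{G,n}$ denotes the number of orbits of $G$ acting on $G^n$ by simultaneous conjugation $g\cdot(x_1,\dots,x_n)=(gx_1g^{-1},\dots,gx_ng^{-1})$, and $\beta_{G,n}$ denotes the number of orbits of the same action on the set $G^{(n)}$ of $n$-tuples of pairwise commuting elements of $G$; $\alpha_{G,0}=\beta_{G,0}=1$. Set $A_G(t)=\sum_{n\ge 0}\alpha_{G,n}t^n$ and $B_G(t)=\sum_{n\ge 0}\beta_{G,n}t^n$ (formal power series, which are rational functions of $t$). $A_G(t/|G|)$, $B_G(t/|G|)$ denote the result of substituting $t/|G|$ for $t$. Finite groups $G,H$ are isoclinic if there are isomorphisms $\theta:G/Z(G)\to H/Z(H)$ and $\phi:G'\to H'$ (derived subgroups) such that $\phi([g_1,g_2])=[h_1,h_2]$ whenever $\theta(g_iZ(G))=h_iZ(H)$ for $i=1,2$. Isoclinism is an equivalence relation, whose classes are called isoclinism families. For a finite $2$-group $G$, the rank of (the family of) $G$ is the smallest $r$ such that the isoclinism family of $G$ contains a group of order $2^r$. $\Gamma_7$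 (Hall–Senior notation) is the isoclinism family, of rank 5, of the group of order $32$ $$\Gamma_7a_1=\langle \alpha, \beta_1,\beta_2,\beta_3 \mid \beta_1^2 = \beta_2^2 = \beta_3^2 = \alpha^4 = 1,\ \alpha\beta_2\alpha^{-1} = \beta_1\beta_2,\ \alpha\beta_3\alpha^{-1} = \beta_2\beta_3 \rangle ,$$ where by convention pairs of generators for which no conjugation relation is listed commute. $G$ belongs to $\Gamma_7$ if $G$ is a finite $2$-group isoclinic to this group. *)

theory Defs
  imports "HOL-Algebra.Algebra" "HOL-Computational_Algebra.Formal_Power_Series"
begin

section \<open>Orbits of simultaneous conjugation\<close>

definition conj_action :: "('a, 'b) monoid_scheme \<Rightarrow> 'a \<Rightarrow> 'a list \<Rightarrow> 'a list" where
  "conj_action G g xs = map (\<lambda>x. g \<otimes>\<^bsub>G\<^esub> x \<otimes>\<^bsub>G\<^esub> inv\<^bsub>G\<^esub> g) xs"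

definition tuples :: "('a, 'b) monoid_scheme \<Rightarrow> nat \<Rightarrow> 'a list set" where
  "tuples G n = {xs. set xs \<subseteq> carrier G \<and> length xs = n}"

definition commuting_tuples :: "('a, 'b) monoid_scheme \<Rightarrow> nat \<Rightarrow> 'a list set" where
  "commuting_tuples G n =
     {xs \<in> tuples G n. \<forall>x\<in>set xs. \<forall>y\<in>set xs. x \<otimes>\<^bsub>G\<^esub> y = y \<otimes>\<^bsub>G\<^esub> x}"

definition alpha :: "('a, 'b) monoid_scheme \<Rightarrow> nat \<Rightarrow> nat" where
  "alpha G n = card (orbits G (tuples G n) (conj_action G))"

definition beta :: "('a, 'b) monoid_scheme \<Rightarrow> nat \<Rightarrow> nat" where
  "beta G n = card (orbits G (commuting_tuples G n) (conj_action G))"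

definition A_series :: "('a, 'b) monoid_scheme \<Rightarrow> rat fps" where
  "A_series G = Abs_fps (\<lambda>n. of_nat (alpha G n))"

definition B_series :: "('a, 'b) monoid_scheme \<Rightarrow> rat fps" where
  "B_series G = Abs_fps (\<lambda>n. of_nat (beta G n))"


section \<open>Isoclinism\<close>

definition centre :: "('a, 'b) monoid_scheme \<Rightarrow> 'a set" where
  "centre G = {z \<in> carrier G. \<forall>x\<in>carrier G. z \<otimes>\<^bsub>G\<^esub> x = x \<otimes>\<^bsub>G\<^esub> z}"

definition commutator :: "('a, 'b) monoid_scheme \<Rightarrow> 'a \<Rightarrow> 'a \<Rightarrow> 'a" where
  "commutator G x y = x \<otimes>\<^bsub>G\<^esub> y \<otimes>\<^bsub>G\<^esub> inv\<^bsub>G\<^esub> x \<otimes>\<^bsub>G\<^esub> inv\<^bsub>G\<^esub> y"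

text \<open>The elements of \<open>G Mod N\<close> are right cosets, hence \<open>#>\<close> below; for the centre they
  coincide with the left cosets.\<close>

definition isoclinic :: "('a, 'b) monoid_scheme \<Rightarrow> ('c, 'd) monoid_scheme \<Rightarrow> bool" where
  "isoclinic G H \<longleftrightarrow>
     (\<exists>\<theta> \<phi>. \<theta> \<in> iso (G Mod centre G) (H Mod centre H) \<and>
        \<phi> \<in> iso (G\<lparr>carrier := derived G (carrier G)\<rparr>) (H\<lparr>carrier := derived H (carrier H)\<rparr>) \<and>
        (\<forall>g1\<in>carrier G. \<forall>g2\<in>carrier G. \<forall>h1\<in>carrier H. \<forall>h2\<in>carrier H.
           \<theta> (centre G #>\<^bsub>G\<^esub> g1) = centre H #>\<^bsub>H\<^esub> h1 \<longrightarrow>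
           \<theta> (centre G #>\<^bsub>G\<^esub> g2) = centre H #>\<^bsub>H\<^esub> h2 \<longrightarrow>
           \<phi> (commutator G g1 g2) = commutator H h1 h2))"

text \<open>Every finite group is isomorphic to one whose carrier is a set of natural numbers, so
  restricting the other members of the family to the type \<^typ>\<open>nat monoid\<close> is no loss of
  generality. The value is meaningful for finite 2-groups only.\<close>

definition isoclinism_rank :: "('a, 'b) monoid_scheme \<Rightarrow> nat" where
  "isoclinism_rank G =
     (LEAST r. \<exists>H :: nat monoid. group H \<and> order H = 2 ^ r \<and> isoclinic G H)"


section \<open>Groups given by generators and relations\<close>

text \<open>A word is a list of letters \<open>(x, True)\<close>, standing for the generator \<open>x\<close>, and
  \<open>(x, False)\<close>, standing for its inverse. A pair \<open>(l, r)\<close> of words is the relation \<open>l = r\<close>.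
  Every element of the type of generators is a generator.\<close>

type_synonym 'g word = "('g \<times> bool) list"

inductive word_eq :: "('g word \<times> 'g word) set \<Rightarrow> 'g word \<Rightarrow> 'g word \<Rightarrow> bool"
  for R where
  refl: "word_eq R w w"
| sym: "word_eq R v w \<Longrightarrow> word_eq R w v"
| trans: "word_eq R u v \<Longrightarrow> word_eq R v w \<Longrightarrow> word_eq R u w"
| cancel: "word_eq R (u @ [(x, b), (x, \<not> b)] @ v) (u @ v)"
| relation: "(l, r) \<in> R \<Longrightarrow> word_eq R (u @ l @ v) (u @ r @ v)"

definition presented_group :: "('g word \<times> 'g word) set \<Rightarrow> 'g word set monoid" where
  "presented_group R =
     \<lparr>carrier = UNIV // {(v, w). word_eq R v w},
      monoid.mult = (\<lambda>S T. {w. \<exists>x\<in>S. \<exists>y\<in>T. word_eq R w (x @ y)}),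
      one = {w. word_eq R w []}\<rparr>"

lemma equiv_word_eq: "equiv UNIV {(v, w). word_eq R v w}"
  by (auto intro!: equivI refl_onI symI transI intro: word_eq.intros)

lemma word_eq_append_left: "word_eq R v w \<Longrightarrow> word_eq R (u @ v) (u @ w)"
proof (induction rule: word_eq.induct)
  case (cancel u' x b v)
  show ?case using word_eq.cancel[of R "u @ u'" x b v] by simp
next
  case (relation l r u' v)
  then show ?case using word_eq.relation[of l r R "u @ u'" v] by simp
qed (auto intro: word_eq.intros)

lemma word_eq_append_right: "word_eq R v w \<Longrightarrow> word_eq R (v @ u) (w @ u)"
proof (induction rule: word_eq.induct)
  case (cancel u' x b v)
  show ?case using word_eq.cancel[of R u' x b "v @ u"] by simp
next
  case (relation l r u' v)
  then show ?case using word_eq.relation[of l r R u' "v @ u"] by simp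
qed (auto intro: word_eq.intros)

lemma word_eq_append:
  "word_eq R v v' \<Longrightarrow> word_eq R w w' \<Longrightarrow> word_eq R (v @ w) (v' @ w')"
  by (meson word_eq.trans word_eq_append_left word_eq_append_right)

definition word_class :: "('g word \<times> 'g word) set \<Rightarrow> 'g word \<Rightarrow> 'g word set" where
  "word_class R w = {v. word_eq R v w}"

lemma word_class_eq_iff: "word_class R v = word_class R w \<longleftrightarrow> word_eq R v w"
  unfolding word_class_def by (auto intro: word_eq.intros)

lemma carrier_presented_group: "carrier (presented_group R) = range (word_class R)"
proof -
  have "{(v, w). word_eq R v w} `` {w} = word_class R w" for w
    unfolding word_class_def by (auto intro: word_eq.sym)
  then show ?thesis
    unfolding presented_group_def quotient_def by auto
qed

lemma one_presented_group: "\<one>\<^bsub>presented_group R\<^esub> = word_class R []"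
  by (simp add: presented_group_def word_class_def)

lemma mult_presented_group:
  "word_class R v \<otimes>\<^bsub>presented_group R\<^esub> word_class R w = word_class R (v @ w)"
  unfolding presented_group_def word_class_def
  by (auto intro: word_eq.refl word_eq.trans word_eq_append)

lemma word_eq_left_inverse: "word_eq R (rev (map (\<lambda>(x, b). (x, \<not> b)) w) @ w) []"
proof (induction w)
  case Nil
  show ?case by (simp add: word_eq.refl)
next
  case (Cons a w)
  obtain x b where a: "a = (x, b)" by (cases a)
  show ?case
    using word_eq.cancel[of R "rev (map (\<lambda>(x, b). (x, \<not> b)) w)" x "\<not> b" w] Cons
    by (auto simp: a intro: word_eq.trans)
qed

lemma group_presented_group: "group (presented_group R)"
proof (rule groupI)
  fix S assume "S \<in> carrier (presented_group R)"
  then obtain w where w: "S = word_class R w"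
    by (auto simp: carrier_presented_group)
  show "\<exists>T\<in>carrier (presented_group R). T \<otimes>\<^bsub>presented_group R\<^esub> S = \<one>\<^bsub>presented_group R\<^esub>"
    by (rule bexI[of _ "word_class R (rev (map (\<lambda>(x, b). (x, \<not> b)) w))"])
       (auto simp: w mult_presented_group one_presented_group word_class_eq_iff
         word_eq_left_inverse carrier_presented_group)
qed (auto simp: carrier_presented_group one_presented_group mult_presented_group)


section \<open>The family \<open>\<Gamma>\<^sub>7\<close>\<close>

datatype gen = Alpha | Beta1 | Beta2 | Beta3

abbreviation pos :: "'g \<Rightarrow> 'g \<times> bool" where "pos x \<equiv> (x, True)"
abbreviation neg :: "'g \<Rightarrow> 'g \<times> bool" where "neg x \<equiv> (x, False)"

text \<open>The last four relations are those left implicit by the convention that generators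
  without a listed conjugation relation commute.\<close>

definition Gamma7a1 :: "gen word set monoid" where
  "Gamma7a1 = presented_group
     {([pos Beta1, pos Beta1], []),
      ([pos Beta2, pos Beta2], []),
      ([pos Beta3, pos Beta3], []),
      ([pos Alpha, pos Alpha, pos Alpha, pos Alpha], []),
      ([pos Alpha, pos Beta2, neg Alpha], [pos Beta1, pos Beta2]),
      ([pos Alpha, pos Beta3, neg Alpha], [pos Beta2, pos Beta3]),
      ([pos Alpha, pos Beta1], [pos Beta1, pos Alpha]),
      ([pos Beta1, pos Beta2], [pos Beta2, pos Beta1]),
      ([pos Beta1, pos Beta3], [pos Beta3, pos Beta1]),
      ([pos Beta2, pos Beta3], [pos Beta3, pos Beta2])}"

definition in_Gamma7 :: "('a, 'b) monoid_scheme \<Rightarrow> bool" where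
  "in_Gamma7 G \<longleftrightarrow> group G \<and> (\<exists>k. order G = 2 ^ k) \<and> isoclinic G Gamma7a1"

end

theory Submission
  imports Defs
begin

text \<open>By Burnside's lemma \<open>|G| \<alpha>\<^sub>n\<close> is the sum over \<open>x\<close> of the \<open>n\<close>-th power of the
  size of the centraliser of \<open>x\<close>, and \<open>|G| \<beta>\<^sub>n\<close> is the number of commuting
  \<open>(n + 1)\<close>-tuples. Both depend only on the relation of commuting, which lives on the
  quotient by the centre, so that after division by powers of \<open>|G|\<close> they are invariant under
  isoclinism. For \<open>\<Gamma>\<^sub>7a\<^sub>1\<close> the quotient by the centre has 16 elements, and the commuting
  relation is, in coordinates, the vanishing of two alternating bilinear forms over the field
  with two elements; besides the identity there are 3 elements with a centraliser of index 2 and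
  12 elements whose centraliser is abelian of index 4.\<close>

section \<open>Counting related tuples\<close>

text \<open>With \<open>R\<close> the commuting relation this is the Burnside sum for
  \<open>alpha\<close>; a free \<open>R\<close> lets the same count be carried to the central
  quotient and to coordinates.\<close>

definition star_count :: "('a \<Rightarrow> 'a \<Rightarrow> bool) \<Rightarrow> nat \<Rightarrow> 'a set \<Rightarrow> nat" where
  "star_count R n S = (\<Sum>x\<in>S. card {y\<in>S. R x y} ^ n)"

text \<open>For finite \<open>S\<close> and reflexive, symmetric \<open>R\<close> this is the number
  of pairwise related \<open>n\<close>-tuples in \<open>S\<close>, organised by first entry.\<close>

primrec clique_count :: "('a \<Rightarrow> 'a \<Rightarrow> bool) \<Rightarrow> nat \<Rightarrow> 'a set \<Rightarrow> nat" where
  "clique_count R 0 S = 1"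
| "clique_count R (Suc n) S = (\<Sum>x\<in>S. clique_count R n {y\<in>S. R x y})"

lemma card_pairwise_lists:
  assumes "finite S" and R_refl: "\<And>x. R x x" and R_sym: "\<And>x y. R x y \<Longrightarrow> R y x"
  shows "card {xs. set xs \<subseteq> S \<and> length xs = n \<and> (\<forall>x\<in>set xs. \<forall>y\<in>set xs. R x y)} = clique_count R n S"
  using assms(1)
proof (induction n arbitrary: S)
  case 0
  have "{xs. set xs \<subseteq> S \<and> length xs = 0 \<and> (\<forall>x\<in>set xs. \<forall>y\<in>set xs. R x y)} = {[]}"
    by auto
  then show ?case by simp
next
  case (Suc n)
  let ?L = "\<lambda>n S. {xs. set xs \<subseteq> S \<and> length xs = n \<and> (\<forall>x\<in>set xs. \<forall>y\<in>set xs. R x y)}"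
  have fin: "finite (?L n {y\<in>S. R x y})" for x
    by (rule finite_subset[OF _ finite_lists_length_eq[OF Suc.prems, of n]]) auto
  \<comment> \<open>The head is split off: reflexivity relates \<open>x\<close> to itself, symmetry
    gives the pairs with \<open>x\<close> in second place.\<close>
  have "?L (Suc n) S = (\<Union>x\<in>S. (#) x ` ?L n {y\<in>S. R x y})"
  proof (intro equalityI subsetI)
    fix xs assume "xs \<in> ?L (Suc n) S"
    then show "xs \<in> (\<Union>x\<in>S. (#) x ` ?L n {y\<in>S. R x y})"
      by (cases xs) (auto simp: image_iff)
  qed (use R_refl R_sym in \<open>auto simp: subset_eq\<close>)
  then have "card (?L (Suc n) S) = (\<Sum>x\<in>S. card ((#) x ` ?L n {y\<in>S. R x y}))"
    using Suc.prems fin by (simp only:) (subst card_UN_disjoint; auto)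
  also have "\<dots> = (\<Sum>x\<in>S. card (?L n {y\<in>S. R x y}))"
    by (intro sum.cong card_image) auto
  also have "\<dots> = clique_count R (Suc n) S"
    using Suc by simp
  finally show ?case .
qed

section \<open>Counting along maps with fibres of constant size\<close>

definition k_to_one_on :: "nat \<Rightarrow> ('a \<Rightarrow> 'b) \<Rightarrow> 'a set \<Rightarrow> 'b set \<Rightarrow> bool" where
  "k_to_one_on k f S T \<longleftrightarrow> finite S \<and> f ` S = T \<and> (\<forall>t\<in>T. card {x\<in>S. f x = t} = k)"

lemma bij_betw_imp_k_to_one_on:
  assumes "bij_betw f S T" "finite S"
  shows "k_to_one_on 1 f S T"
proof -
  have "{x\<in>S. f x = f y} = {y}" if "y \<in> S" for y
    using that assms(1) by (auto simp: bij_betw_def inj_on_def)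
  then show ?thesis
    using assms unfolding k_to_one_on_def bij_betw_def by auto
qed

lemma sum_k_to_one:
  assumes "k_to_one_on k f S T"
  shows "(\<Sum>x\<in>S. g (f x)) = k * (\<Sum>t\<in>T. g t)"
proof -
  have "(\<Sum>x\<in>S. g (f x)) = (\<Sum>t\<in>T. \<Sum>x\<in>{x\<in>S. f x = t}. g (f x))"
    using assms unfolding k_to_one_on_def by (intro sum.group[symmetric]) auto
  also have "\<dots> = (\<Sum>t\<in>T. k * g t)"
    using assms unfolding k_to_one_on_def by (intro sum.cong) auto
  finally show ?thesis by (simp add: sum_distrib_left)
qed

lemma card_k_to_one:
  assumes "k_to_one_on k f S T"
  shows "card S = k * card T"
  using sum_k_to_one[OF assms, of "\<lambda>_. 1"] by simp

text \<open>Since \<open>R\<close> depends only on images under \<open>f\<close>, the elements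
  related to \<open>x\<close> form a union of whole fibres.\<close>

lemma k_to_one_on_restrict:
  assumes "k_to_one_on k f S T"
    and "\<And>x y. x \<in> S \<Longrightarrow> y \<in> S \<Longrightarrow> R x y \<longleftrightarrow> R' (f x) (f y)"
    and "x \<in> S"
  shows "k_to_one_on k f {y\<in>S. R x y} {t\<in>T. R' (f x) t}"
proof -
  have "{y \<in> {y\<in>S. R x y}. f y = t} = {y\<in>S. f y = t}" if "R' (f x) t" for t
    using that assms(2,3) by auto
  then show ?thesis
    using assms unfolding k_to_one_on_def by auto
qed

text \<open>One factor \<open>k\<close> comes from the choice of \<open>x\<close> in its fibre,
  \<open>n\<close> more from the \<open>n\<close>-th power of the neighbourhood size.\<close>

lemma star_count_k_to_one:
  assumes "k_to_one_on k f S T"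
    and "\<And>x y. x \<in> S \<Longrightarrow> y \<in> S \<Longrightarrow> R x y \<longleftrightarrow> R' (f x) (f y)"
  shows "star_count R n S = k ^ Suc n * star_count R' n T"
proof -
  have "star_count R n S = (\<Sum>x\<in>S. (k * card {t\<in>T. R' (f x) t}) ^ n)"
    unfolding star_count_def
    using card_k_to_one[OF k_to_one_on_restrict[where R = R and R' = R', OF assms]]
    by (intro sum.cong) auto
  also have "\<dots> = k * (\<Sum>s\<in>T. (k * card {t\<in>T. R' s t}) ^ n)"
    by (rule sum_k_to_one[OF assms(1)])
  finally show ?thesis
    by (simp add: star_count_def power_mult_distrib sum_distrib_left mult.assoc)
qed

text \<open>Each of the \<open>n\<close> entries varies freely in its fibre.\<close>

lemma clique_count_k_to_one:
  assumes "k_to_one_on k f S T"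
    and "\<And>x y. x \<in> S \<Longrightarrow> y \<in> S \<Longrightarrow> R x y \<longleftrightarrow> R' (f x) (f y)"
  shows "clique_count R n S = k ^ n * clique_count R' n T"
  using assms
proof (induction n arbitrary: S T)
  case (Suc n)
  have "clique_count R (Suc n) S = (\<Sum>x\<in>S. clique_count R n {y\<in>S. R x y})"
    by simp
  also have "\<dots> = (\<Sum>x\<in>S. k ^ n * clique_count R' n {t\<in>T. R' (f x) t})"
    using Suc.prems
    by (intro sum.cong refl Suc.IH k_to_one_on_restrict) auto
  also have "\<dots> = k * (\<Sum>s\<in>T. k ^ n * clique_count R' n {t\<in>T. R' s t})"
    by (rule sum_k_to_one[OF Suc.prems(1)])
  finally show ?case
    by (simp add: sum_distrib_left mult.assoc)
qed simp

lemma clique_count_of_clique: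
  assumes "\<And>x y. x \<in> S \<Longrightarrow> y \<in> S \<Longrightarrow> R x y"
  shows "clique_count R n S = card S ^ n"
proof (induction n)
  case (Suc n)
  have "{y\<in>S. R x y} = S" if "x \<in> S" for x
    using assms that by auto
  then show ?case
    using Suc by simp
qed simp

text \<open>Serves as a linear recursion in \<open>n\<close>: a first entry from the radical
  \<open>C\<close> imposes no restriction on the rest.\<close>

lemma clique_count_Suc_split:
  assumes "finite S" "C \<subseteq> S"
    and "\<And>x. x \<in> C \<Longrightarrow> {y\<in>S. R x y} = S"
    and "\<And>x. x \<in> S - C \<Longrightarrow> clique_count R n {y\<in>S. R x y} = a x"
  shows "clique_count R (Suc n) S = card C * clique_count R n S + (\<Sum>x\<in>S - C. a x)"
  using assms by (simp add: sum.subset_diff[of C S])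

section \<open>Isoclinic groups\<close>

definition commutes :: "('a, 'b) monoid_scheme \<Rightarrow> 'a \<Rightarrow> 'a \<Rightarrow> bool" where
  "commutes G x y \<longleftrightarrow> x \<otimes>\<^bsub>G\<^esub> y = y \<otimes>\<^bsub>G\<^esub> x"

context group
begin

section \<open>Burnside's lemma for simultaneous conjugation\<close>

lemma conj_action_mult:
  assumes "g \<in> carrier G" "h \<in> carrier G" "set xs \<subseteq> carrier G"
  shows "conj_action G (g \<otimes> h) xs = conj_action G g (conj_action G h xs)"
  using assms by (auto simp: conj_action_def subset_eq m_assoc inv_mult_group)

lemma conj_action_one:
  assumes "set xs \<subseteq> carrier G"
  shows "conj_action G \<one> xs = xs"
  using assms by (auto simp: conj_action_def subset_eq intro!: map_idI)

lemma conj_action_fixes_iff: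
  assumes "g \<in> carrier G" "set xs \<subseteq> carrier G"
  shows "conj_action G g xs = xs \<longleftrightarrow> (\<forall>x\<in>set xs. commutes G g x)"
proof -
  have "g \<otimes> x \<otimes> inv g = x \<longleftrightarrow> commutes G g x" if "x \<in> set xs" for x
    using assms that unfolding commutes_def by (metis inv_solve_right' m_closed subsetD)
  then show ?thesis
    using map_eq_conv[of "\<lambda>x. g \<otimes> x \<otimes> inv g" xs id] by (simp add: conj_action_def)
qed

text \<open>The maps are restricted to \<open>E\<close> because \<open>BijGroup E\<close> consists
  of extensional functions.\<close>

lemma group_action_conj_action:
  assumes "E \<subseteq> tuples G n"
    and "\<And>g xs. g \<in> carrier G \<Longrightarrow> xs \<in> E \<Longrightarrow> conj_action G g xs \<in> E"
  shows "group_action G E (\<lambda>g. restrict (conj_action G g) E)"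
proof -
  have E: "set xs \<subseteq> carrier G" if "xs \<in> E" for xs
    using that assms(1) by (auto simp: tuples_def)
  have "bij_betw (conj_action G g) E E" if "g \<in> carrier G" for g
    by (rule bij_betw_byWitness[where f' = "conj_action G (inv g)"])
      (use that assms(2) E in \<open>auto simp flip: conj_action_mult simp: conj_action_one\<close>)
  then have "restrict (conj_action G g) E \<in> Bij E" if "g \<in> carrier G" for g
    using that by (simp add: Bij_def)
  then have "(\<lambda>g. restrict (conj_action G g) E) \<in> hom G (BijGroup E)"
    using E assms(2)
    by (intro homI) (auto simp: BijGroup_def compose_def conj_action_mult intro!: restrict_ext)
  then show ?thesis
    by (simp add: group_action_def group_hom_def group_hom_axioms_def group_BijGroup is_group)
qed

lemma card_orbits_conj_action:
  assumes "finite (carrier G)" "E \<subseteq> tuples G n"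
    and "\<And>g xs. g \<in> carrier G \<Longrightarrow> xs \<in> E \<Longrightarrow> conj_action G g xs \<in> E"
  shows "card (orbits G E (conj_action G)) * order G =
    (\<Sum>g\<in>carrier G. card {xs \<in> E. \<forall>x\<in>set xs. commutes G g x})"
proof -
  interpret group_action G E "\<lambda>g. restrict (conj_action G g) E"
    by (rule group_action_conj_action[OF assms(2,3)])
  have "finite E"
    using finite_subset[OF assms(2)] finite_lists_length_eq[OF assms(1), of n]
    by (simp add: tuples_def)
  \<comment> \<open>Burnside's lemma concerns the restricted action, \<open>alpha\<close> and
    \<open>beta\<close> the unrestricted one; on points of \<open>E\<close> the orbits
    agree.\<close>
  moreover have "orbit G (\<lambda>g. restrict (conj_action G g) E) xs = orbit G (conj_action G) xs"
    if "xs \<in> E" for xs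
    using that by (simp add: orbit_def)
  then have "orbits G E (\<lambda>g. restrict (conj_action G g) E) = orbits G E (conj_action G)"
    unfolding orbits_def by (intro Collect_cong) force
  moreover have "invariants E (\<lambda>g. restrict (conj_action G g) E) g =
      {xs \<in> E. \<forall>x\<in>set xs. commutes G g x}" if "g \<in> carrier G" for g
    using that assms(2) conj_action_fixes_iff by (auto simp: invariants_def tuples_def)
  ultimately show ?thesis
    using burnside[OF assms(1)] by simp
qed

lemma conj_action_in_tuples:
  assumes "g \<in> carrier G" "xs \<in> tuples G n"
  shows "conj_action G g xs \<in> tuples G n"
  using assms by (auto simp: conj_action_def tuples_def subset_eq)

lemma conj_action_in_commuting_tuples:
  assumes "g \<in> carrier G" "xs \<in> commuting_tuples G n"
  shows "conj_action G g xs \<in> commuting_tuples G n"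
proof -
  have "(g \<otimes> x \<otimes> inv g) \<otimes> (g \<otimes> y \<otimes> inv g) = (g \<otimes> y \<otimes> inv g) \<otimes> (g \<otimes> x \<otimes> inv g)"
    if "x \<in> set xs" "y \<in> set xs" for x y
  proof -
    have xy: "x \<in> carrier G" "y \<in> carrier G" "x \<otimes> y = y \<otimes> x"
      using that assms(2) by (auto simp: commuting_tuples_def tuples_def)
    \<comment> \<open>Conjugation is multiplicative, hence preserves commuting.\<close>
    have "(g \<otimes> u \<otimes> inv g) \<otimes> (g \<otimes> v \<otimes> inv g) = g \<otimes> (u \<otimes> v) \<otimes> inv g"
      if "u \<in> carrier G" "v \<in> carrier G" for u v
    proof -
      have "inv g \<otimes> (g \<otimes> w) = w" if "w \<in> carrier G" for w
        using that assms(1) by (simp add: m_assoc[symmetric])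
      then show ?thesis
        using that assms(1) by (simp add: m_assoc)
    qed
    then show ?thesis
      using xy by simp
  qed
  then show ?thesis
    using assms conj_action_in_tuples
    by (auto simp: commuting_tuples_def) (auto simp: conj_action_def)
qed

text \<open>The tuples fixed by \<open>g\<close> are the lists over its centraliser, so their number
  is an \<open>n\<close>-th power.\<close>

lemma alpha_eq_star_count:
  assumes "finite (carrier G)"
  shows "alpha G n * order G = star_count (commutes G) n (carrier G)"
proof -
  have "{xs \<in> tuples G n. \<forall>x\<in>set xs. commutes G g x} =
      {xs. set xs \<subseteq> {y \<in> carrier G. commutes G g y} \<and> length xs = n}" for g
    by (auto simp: tuples_def)
  then show ?thesis
    unfolding alpha_def star_count_def
    by (subst card_orbits_conj_action[OF assms subset_refl conj_action_in_tuples])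
      (simp_all add: card_lists_length_eq assms)
qed

text \<open>A commuting \<open>n\<close>-tuple fixed by \<open>g\<close> becomes a commuting
  \<open>(n + 1)\<close>-tuple with \<open>g\<close> in front, whence \<open>Suc n\<close>.\<close>

lemma beta_eq_clique_count:
  assumes "finite (carrier G)"
  shows "beta G n * order G = clique_count (commutes G) (Suc n) (carrier G)"
proof -
  have "{xs \<in> commuting_tuples G n. \<forall>x\<in>set xs. commutes G g x} =
      {xs. set xs \<subseteq> {y \<in> carrier G. commutes G g y} \<and> length xs = n \<and>
        (\<forall>x\<in>set xs. \<forall>y\<in>set xs. commutes G x y)}" for g
    by (auto simp: commuting_tuples_def tuples_def commutes_def)
  moreover have "card {xs. set xs \<subseteq> {y \<in> carrier G. commutes G g y} \<and> length xs = n \<and>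
      (\<forall>x\<in>set xs. \<forall>y\<in>set xs. commutes G x y)} =
      clique_count (commutes G) n {y \<in> carrier G. commutes G g y}" for g
    using assms by (intro card_pairwise_lists) (auto simp: commutes_def)
  moreover have "commuting_tuples G n \<subseteq> tuples G n"
    by (auto simp: commuting_tuples_def)
  ultimately show ?thesis
    unfolding beta_def
    by (subst card_orbits_conj_action[OF assms _ conj_action_in_commuting_tuples]) simp_all
qed

section \<open>The centre and commuting of its cosets\<close>

lemma centre_closed: "z \<in> centre G \<Longrightarrow> z \<in> carrier G"
  by (simp add: centre_def)

lemma centre_comm: "z \<in> centre G \<Longrightarrow> x \<in> carrier G \<Longrightarrow> z \<otimes> x = x \<otimes> z"
  by (simp add: centre_def)

lemma centreI:
  "z \<in> carrier G \<Longrightarrow> (\<And>x. x \<in> carrier G \<Longrightarrow> z \<otimes> x = x \<otimes> z) \<Longrightarrow> z \<in> centre G"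
  by (simp add: centre_def)

lemma subgroup_centre: "subgroup (centre G) G"
proof
  fix x y assume xy: "x \<in> centre G" "y \<in> centre G"
  note c = xy[THEN centre_closed]
  show "x \<otimes> y \<in> centre G"
  proof (rule centreI)
    fix z assume z: "z \<in> carrier G"
    have "x \<otimes> y \<otimes> z = x \<otimes> (z \<otimes> y)"
      using z c by (simp add: m_assoc centre_comm[OF xy(2) z])
    also have "\<dots> = z \<otimes> x \<otimes> y"
      using z c by (simp add: m_assoc[symmetric] centre_comm[OF xy(1) z])
    finally show "x \<otimes> y \<otimes> z = z \<otimes> (x \<otimes> y)"
      using z c by (simp add: m_assoc)
  qed (use c in simp)
next
  fix x assume x: "x \<in> centre G"
  note c = centre_closed[OF x]
  show "inv x \<in> centre G"
  proof (rule centreI)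
    fix z assume z: "z \<in> carrier G"
    have "inv x \<otimes> z = inv x \<otimes> (z \<otimes> x) \<otimes> inv x"
      using z c by (simp add: m_assoc)
    also have "\<dots> = inv x \<otimes> (x \<otimes> z) \<otimes> inv x"
      by (simp only: centre_comm[OF x z])
    also have "\<dots> = z \<otimes> inv x"
      using z c by (simp add: m_assoc[symmetric])
    finally show "inv x \<otimes> z = z \<otimes> inv x" .
  qed (use c in simp)
qed (auto intro: centreI dest: centre_closed)

text \<open>For cosets of the centre the choice of representatives does not matter, by
  \<open>coset_commutes_iff\<close>.\<close>

definition coset_commutes :: "'a set \<Rightarrow> 'a set \<Rightarrow> bool" where
  "coset_commutes C D \<longleftrightarrow> (\<exists>x\<in>C. \<exists>y\<in>D. commutes G x y)"

lemma commutes_central_mult: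
  assumes "z \<in> centre G" "x \<in> carrier G" "y \<in> carrier G"
  shows "commutes G (z \<otimes> x) y \<longleftrightarrow> commutes G x y"
proof -
  note z = centre_closed[OF assms(1)]
  have "y \<otimes> (z \<otimes> x) = z \<otimes> y \<otimes> x"
    using z assms(2,3) by (simp add: m_assoc[symmetric] centre_comm[OF assms(1,3)])
  then have "y \<otimes> (z \<otimes> x) = z \<otimes> (y \<otimes> x)"
    using z assms(2,3) by (simp add: m_assoc)
  then show ?thesis
    using z assms(2,3) by (simp add: commutes_def m_assoc)
qed

lemma coset_commutes_iff:
  assumes "x \<in> carrier G" "y \<in> carrier G"
  shows "coset_commutes (centre G #> x) (centre G #> y) \<longleftrightarrow> commutes G x y"
proof -
  have "commutes G (z \<otimes> x) (w \<otimes> y) \<longleftrightarrow> commutes G x y" if "z \<in> centre G" "w \<in> centre G" for z w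
  proof -
    have "w \<in> carrier G"
      using that(2) by (rule centre_closed)
    then have "commutes G (z \<otimes> x) (w \<otimes> y) \<longleftrightarrow> commutes G (w \<otimes> y) x"
      using commutes_central_mult[of z x "w \<otimes> y"] that assms by (auto simp: commutes_def)
    also have "\<dots> \<longleftrightarrow> commutes G x y"
      using commutes_central_mult[of w y x] that assms by (auto simp: commutes_def)
    finally show ?thesis .
  qed
  moreover have "centre G \<noteq> {}"
    using subgroup.one_closed[OF subgroup_centre] by auto
  ultimately show ?thesis
    unfolding coset_commutes_def r_coset_def by auto
qed

lemma k_to_one_on_centre_cosets:
  assumes "finite (carrier G)"
  shows "k_to_one_on (card (centre G)) (\<lambda>x. centre G #> x) (carrier G) (rcosets (centre G))"
proof -
  have "card {x \<in> carrier G. centre G #> x = C} = card (centre G)" if "C \<in> rcosets (centre G)" for C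
  proof -
    \<comment> \<open>The fibre over a coset is the coset itself.\<close>
    have "{x \<in> carrier G. centre G #> x = C} = C"
      using that subgroup_centre subgroup.rcosets_carrier[OF subgroup_centre is_group that]
      by (auto simp: RCOSETS_def intro: rcos_self dest: repr_independence)
    then show ?thesis
      using card_rcosets_equal[OF that] subgroup.subset[OF subgroup_centre] by simp
  qed
  then show ?thesis
    using assms by (auto simp: k_to_one_on_def RCOSETS_def)
qed

lemma commutator_eq_one_iff:
  assumes "x \<in> carrier G" "y \<in> carrier G"
  shows "commutator G x y = \<one> \<longleftrightarrow> commutes G x y"
  using assms by (simp add: commutator_def commutes_def inv_solve_right')

lemma commutator_in_derived:
  assumes "x \<in> carrier G" "y \<in> carrier G"
  shows "commutator G x y \<in> derived G (carrier G)"
  using assms unfolding derived_def commutator_def by (intro generate.incl) auto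

end

text \<open>Both counts descend to the central quotients, where the bijection
  \<open>\<theta>\<close> preserves commuting of cosets. Orders are multiplied across so that equal
  proportions are stated in the natural numbers.\<close>

lemma isoclinic_count_transfer:
  assumes "group G" "group H" "finite (carrier G)" "finite (carrier H)" "isoclinic G H"
  shows "star_count (commutes G) n (carrier G) * order H ^ Suc n =
      star_count (commutes H) n (carrier H) * order G ^ Suc n" (is ?star)
    and "clique_count (commutes G) n (carrier G) * order H ^ n =
      clique_count (commutes H) n (carrier H) * order G ^ n" (is ?clique)
proof -
  interpret G: group G by fact
  interpret H: group H by fact
  let ?Q = "rcosets\<^bsub>G\<^esub> (centre G)" and ?R = "rcosets\<^bsub>H\<^esub> (centre H)"
  obtain \<theta> \<phi> where \<theta>: "\<theta> \<in> iso (G Mod centre G) (H Mod centre H)"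
    and \<phi>: "\<phi> \<in> iso (G\<lparr>carrier := derived G (carrier G)\<rparr>) (H\<lparr>carrier := derived H (carrier H)\<rparr>)"
    and comm: "\<And>g1 g2 h1 h2. g1 \<in> carrier G \<Longrightarrow> g2 \<in> carrier G \<Longrightarrow> h1 \<in> carrier H \<Longrightarrow> h2 \<in> carrier H \<Longrightarrow>
        \<theta> (centre G #>\<^bsub>G\<^esub> g1) = centre H #>\<^bsub>H\<^esub> h1 \<Longrightarrow>
        \<theta> (centre G #>\<^bsub>G\<^esub> g2) = centre H #>\<^bsub>H\<^esub> h2 \<Longrightarrow>
        \<phi> (commutator G g1 g2) = commutator H h1 h2"
    using assms(5) unfolding isoclinic_def by blast
  have bij: "bij_betw \<theta> ?Q ?R"
    using \<theta> by (simp add: iso_def FactGroup_def)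
  have "group (G\<lparr>carrier := derived G (carrier G)\<rparr>)" "group (H\<lparr>carrier := derived H (carrier H)\<rparr>)"
    using G.derived_is_subgroup[of "carrier G"] H.derived_is_subgroup[of "carrier H"]
    by (auto intro: subgroup.subgroup_is_group G.is_group H.is_group)
  then have \<phi>_one: "\<phi> \<one>\<^bsub>G\<^esub> = \<one>\<^bsub>H\<^esub>"
    using hom_one[of \<phi> "G\<lparr>carrier := derived G (carrier G)\<rparr>" "H\<lparr>carrier := derived H (carrier H)\<rparr>"] \<phi>
    by (simp add: iso_def)
  have inj: "inj_on \<phi> (derived G (carrier G))"
    using \<phi> by (simp add: iso_def bij_betw_def)
  have one: "\<one>\<^bsub>G\<^esub> \<in> derived G (carrier G)"
    unfolding derived_def by (rule generate.one)
  have rel: "G.coset_commutes C D \<longleftrightarrow> H.coset_commutes (\<theta> C) (\<theta> D)" if C: "C \<in> ?Q" and D: "D \<in> ?Q" for C D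
  proof -
    obtain g1 g2 where g: "g1 \<in> carrier G" "g2 \<in> carrier G" "C = centre G #>\<^bsub>G\<^esub> g1" "D = centre G #>\<^bsub>G\<^esub> g2"
      using C D by (auto simp: RCOSETS_def)
    have "\<theta> C \<in> ?R" "\<theta> D \<in> ?R"
      using bij C D by (auto simp: bij_betw_def)
    then obtain h1 h2 where h: "h1 \<in> carrier H" "h2 \<in> carrier H"
      "\<theta> C = centre H #>\<^bsub>H\<^esub> h1" "\<theta> D = centre H #>\<^bsub>H\<^esub> h2"
      by (auto simp: RCOSETS_def)
    \<comment> \<open>Commuting means trivial commutator, and \<open>\<phi>\<close>, injective on
      the derived subgroup, sends only the identity to the identity.\<close>
    have "commutes G g1 g2 \<longleftrightarrow> \<phi> (commutator G g1 g2) = \<phi> \<one>\<^bsub>G\<^esub>"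
      using inj_on_eq_iff[OF inj G.commutator_in_derived[OF g(1,2)] one] G.commutator_eq_one_iff[OF g(1,2)]
      by simp
    also have "\<dots> \<longleftrightarrow> commutes H h1 h2"
      using comm[OF g(1,2) h(1,2)] g(3,4) h(3,4) H.commutator_eq_one_iff[OF h(1,2)] \<phi>_one by simp
    finally show ?thesis
      using G.coset_commutes_iff[OF g(1,2)] H.coset_commutes_iff[OF h(1,2)] g(3,4) h(3,4) by simp
  qed
  note kG = G.k_to_one_on_centre_cosets[OF assms(3)] and kH = H.k_to_one_on_centre_cosets[OF assms(4)]
  have fin: "finite ?Q"
    using kG unfolding k_to_one_on_def by (metis finite_imageI)
  note k\<theta> = bij_betw_imp_k_to_one_on[OF bij fin]
  \<comment> \<open>The quotients have equal size by \<open>bij\<close>, so the orders differ only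
    through the centres.\<close>
  have orders: "order G = card (centre G) * card ?Q" "order H = card (centre H) * card ?Q"
    using card_k_to_one[OF kG] card_k_to_one[OF kH] bij_betw_same_card[OF bij] by (simp_all add: order_def)
  show ?star
    using star_count_k_to_one[OF kG, of "commutes G" G.coset_commutes n]
      star_count_k_to_one[OF kH, of "commutes H" H.coset_commutes n]
      star_count_k_to_one[where R = G.coset_commutes and R' = H.coset_commutes and n = n, OF k\<theta> rel]
    by (simp add: G.coset_commutes_iff H.coset_commutes_iff orders power_mult_distrib del: power_Suc)
  show ?clique
    using clique_count_k_to_one[OF kG, of "commutes G" G.coset_commutes n]
      clique_count_k_to_one[OF kH, of "commutes H" H.coset_commutes n]
      clique_count_k_to_one[where R = G.coset_commutes and R' = H.coset_commutes and n = n, OF k\<theta> rel]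
    by (simp add: G.coset_commutes_iff H.coset_commutes_iff orders power_mult_distrib)
qed

section \<open>A model of the presented group\<close>

text \<open>The tuple \<open>(x, y, z, i, j)\<close> stands for \<open>\<beta>\<^sub>1\<^sup>x \<beta>\<^sub>2\<^sup>y \<beta>\<^sub>3\<^sup>z \<alpha>\<^sup>2\<^sup>i\<^sup>+\<^sup>j\<close>,
  and \<open>lmul\<close> is left multiplication by a letter.\<close>

type_synonym gamma = "bool \<times> bool \<times> bool \<times> bool \<times> bool"

fun lmul :: "gen \<times> bool \<Rightarrow> gamma \<Rightarrow> gamma" where
  "lmul (Beta1, _) (x, y, z, i, j) = (\<not> x, y, z, i, j)"
| "lmul (Beta2, _) (x, y, z, i, j) = (x, \<not> y, z, i, j)"
| "lmul (Beta3, _) (x, y, z, i, j) = (x, y, \<not> z, i, j)"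
| "lmul (Alpha, True) (x, y, z, i, j) = (x \<noteq> y, y \<noteq> z, z, i \<noteq> j, \<not> j)"
| "lmul (Alpha, False) (x, y, z, i, j) = (x \<noteq> (y \<noteq> z), y \<noteq> z, z, i = j, \<not> j)"

fun normal_word :: "gamma \<Rightarrow> gen word" where
  "normal_word (x, y, z, i, j) =
     (if x then [pos Beta1] else []) @ (if y then [pos Beta2] else []) @
     (if z then [pos Beta3] else []) @ (if i then [pos Alpha, pos Alpha] else []) @
     (if j then [pos Alpha] else [])"

abbreviation gamma_one :: gamma where
  "gamma_one \<equiv> (False, False, False, False, False)"

definition lmul_word :: "gen word \<Rightarrow> gamma \<Rightarrow> gamma" where
  "lmul_word = foldr lmul"

definition gamma_mult :: "gamma \<Rightarrow> gamma \<Rightarrow> gamma" where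
  "gamma_mult p q = lmul_word (normal_word p) q"

abbreviation gamma_rel :: "gamma \<Rightarrow> gamma \<Rightarrow> bool" where
  "gamma_rel p q \<equiv> gamma_mult p q = gamma_mult q p"

definition relators :: "(gen word \<times> gen word) set" where
  "relators =
     {([pos Beta1, pos Beta1], []),
      ([pos Beta2, pos Beta2], []),
      ([pos Beta3, pos Beta3], []),
      ([pos Alpha, pos Alpha, pos Alpha, pos Alpha], []),
      ([pos Alpha, pos Beta2, neg Alpha], [pos Beta1, pos Beta2]),
      ([pos Alpha, pos Beta3, neg Alpha], [pos Beta2, pos Beta3]),
      ([pos Alpha, pos Beta1], [pos Beta1, pos Alpha]),
      ([pos Beta1, pos Beta2], [pos Beta2, pos Beta1]),
      ([pos Beta1, pos Beta3], [pos Beta3, pos Beta1]),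
      ([pos Beta2, pos Beta3], [pos Beta3, pos Beta2])}"

lemma Gamma7a1_eq: "Gamma7a1 = presented_group relators"
  by (simp add: Gamma7a1_def relators_def)

section \<open>Normal forms in the presented group\<close>

lemma lmul_cancel: "lmul (g, b) (lmul (g, \<not> b) p) = p"
  by (cases p; cases g; cases b) auto

text \<open>Soundness of the model: every relation holds between the maps on the 32 tuples, so a
  word acts through its class.\<close>

lemma lmul_word_cong: "word_eq relators v w \<Longrightarrow> lmul_word v = lmul_word w"
proof (induction rule: word_eq.induct)
  case (cancel u x b v)
  show ?case by (simp add: lmul_word_def fun_eq_iff lmul_cancel[of x b, simplified])
next
  case (relation l r u v)
  have "lmul_word l p = lmul_word r p" for p
    using relation by (cases p) (auto simp: relators_def lmul_word_def)
  then show ?case by (simp add: lmul_word_def fun_eq_iff)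
qed auto

lemma lmul_word_normal_word: "lmul_word (normal_word p) gamma_one = p"
  by (cases p) (auto simp: lmul_word_def)

text \<open>Completeness of the model: relations and cancellation bring a generator times a normal
  word back to normal form, so every class contains a normal word.\<close>

lemma word_class_lmul_pos:
  "word_class relators (pos g # normal_word p) = word_class relators (normal_word (lmul (pos g) p))"
proof -
  define W where "W = word_class relators"
  have relI: "W (l @ v) = W (r @ v)" if "(l, r) \<in> relators" for l r v
    using word_eq.relation[OF that, of "[]" v] by (simp add: W_def word_class_eq_iff)
  \<comment> \<open>Inserting the inverse of \<open>Alpha\<close> followed by \<open>Alpha\<close>
    turns a conjugation relation into a rule moving \<open>Alpha\<close> to the right past
    \<open>h\<close>.\<close>
  have conj: "W (pos Alpha # pos h # v) = W (r @ pos Alpha # v)"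
    if "([pos Alpha, pos h, neg Alpha], r) \<in> relators" for h r v
  proof -
    have "W (pos Alpha # pos h # v) = W ([pos Alpha, pos h] @ [(Alpha, False), (Alpha, \<not> False)] @ v)"
      unfolding W_def word_class_eq_iff
      using word_eq.sym[OF word_eq.cancel[of relators "[pos Alpha, pos h]" Alpha False v]] by simp
    also have "\<dots> = W (r @ pos Alpha # v)"
      using relI[OF that, of "pos Alpha # v"] by simp
    finally show ?thesis .
  qed
  have prefix: "W (x # v) = W (x # w)" if "W v = W w" for x v w
    using that word_eq_append_left[of relators v w "[x]"] by (simp add: W_def word_class_eq_iff)
  \<comment> \<open>As equations between operators \<open>L\<close> on classes, the relations become rewrite rules that apply
    below any prefix.\<close>
  define L where "L x S = W (x # (SOME v. S = W v))" for x S
  \<comment> \<open>By \<open>prefix\<close> the chosen \<open>v\<close> is immaterial.\<close>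
  have L: "W (x # v) = L x (W v)" for x v
    unfolding L_def by (rule prefix) (rule someI[where P = "\<lambda>u. W v = W u", OF HOL.refl])
  have rels0:
    "L (pos Beta1) (L (pos Beta1) (W v)) = W v"
    "L (pos Beta2) (L (pos Beta2) (W v)) = W v"
    "L (pos Beta3) (L (pos Beta3) (W v)) = W v"
    "L (pos Alpha) (L (pos Alpha) (L (pos Alpha) (L (pos Alpha) (W v)))) = W v"
    "L (pos Alpha) (L (pos Beta1) (W v)) = L (pos Beta1) (L (pos Alpha) (W v))"
    "L (pos Beta2) (L (pos Beta1) (W v)) = L (pos Beta1) (L (pos Beta2) (W v))"
    "L (pos Beta3) (L (pos Beta1) (W v)) = L (pos Beta1) (L (pos Beta3) (W v))"
    "L (pos Beta3) (L (pos Beta2) (W v)) = L (pos Beta2) (L (pos Beta3) (W v))"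
    "L (pos Alpha) (L (pos Beta2) (W v)) = L (pos Beta1) (L (pos Beta2) (L (pos Alpha) (W v)))"
    "L (pos Alpha) (L (pos Beta3) (W v)) = L (pos Beta2) (L (pos Beta3) (L (pos Alpha) (W v)))"
    for v
    using relI[of "[pos Beta1, pos Beta1]" "[]" v] relI[of "[pos Beta2, pos Beta2]" "[]" v]
      relI[of "[pos Beta3, pos Beta3]" "[]" v]
      relI[of "[pos Alpha, pos Alpha, pos Alpha, pos Alpha]" "[]" v]
      relI[of "[pos Alpha, pos Beta1]" "[pos Beta1, pos Alpha]" v]
      relI[of "[pos Beta1, pos Beta2]" "[pos Beta2, pos Beta1]" v]
      relI[of "[pos Beta1, pos Beta3]" "[pos Beta3, pos Beta1]" v]
      relI[of "[pos Beta2, pos Beta3]" "[pos Beta3, pos Beta2]" v]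
      conj[of Beta2 "[pos Beta1, pos Beta2]" v] conj[of Beta3 "[pos Beta2, pos Beta3]" v]
    by (simp_all add: relators_def L)
  have rels:
    "L (pos Beta1) (L (pos Beta1) S) = S"
    "L (pos Beta2) (L (pos Beta2) S) = S"
    "L (pos Beta3) (L (pos Beta3) S) = S"
    "L (pos Alpha) (L (pos Alpha) (L (pos Alpha) (L (pos Alpha) S))) = S"
    "L (pos Alpha) (L (pos Beta1) S) = L (pos Beta1) (L (pos Alpha) S)"
    "L (pos Beta2) (L (pos Beta1) S) = L (pos Beta1) (L (pos Beta2) S)"
    "L (pos Beta3) (L (pos Beta1) S) = L (pos Beta1) (L (pos Beta3) S)"
    "L (pos Beta3) (L (pos Beta2) S) = L (pos Beta2) (L (pos Beta3) S)"
    "L (pos Alpha) (L (pos Beta2) S) = L (pos Beta1) (L (pos Beta2) (L (pos Alpha) S))"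
    "L (pos Alpha) (L (pos Beta3) S) = L (pos Beta2) (L (pos Beta3) (L (pos Alpha) S))"
    if "S \<in> range W" for S
    using that rels0 by auto
  have clos: "L x S \<in> range W" if "S \<in> range W" for x S
    using that by (auto simp flip: L)
  obtain x y z i j where p: "p = (x, y, z, i, j)"
    by (metis surj_pair)
  show ?thesis
    unfolding p W_def[symmetric]
    \<comment> \<open>In each of the 128 cases the rules sort the letters into the order
      \<open>Beta1\<close>, \<open>Beta2\<close>, \<open>Beta3\<close>, \<open>Alpha\<close> and
      delete trivial powers; \<open>clos\<close> discharges the range conditions.\<close>
    by (cases g; cases x; cases y; cases z; cases i; cases j) (simp_all add: L rels clos)
qed

text \<open>An inverse letter reduces to a positive one, since \<open>pos g\<close> takes
  \<open>lmul (neg g) p\<close> back to \<open>p\<close>.\<close>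

lemma word_class_lmul:
  "word_class relators (l # normal_word p) = word_class relators (normal_word (lmul l p))"
proof -
  obtain g b where l: "l = (g, b)" by (cases l)
  show ?thesis
  proof (cases b)
    case True
    then show ?thesis using word_class_lmul_pos l by simp
  next
    case False
    have "lmul (pos g) (lmul (neg g) p) = p"
      using lmul_cancel[of g True p] by simp
    then have "word_eq relators (normal_word p) (pos g # normal_word (lmul (neg g) p))"
      using word_class_lmul_pos[of g "lmul (neg g) p"]
      by (simp add: word_class_eq_iff word_eq.sym)
    then have "word_eq relators ([neg g] @ normal_word p) ([neg g] @ pos g # normal_word (lmul (neg g) p))"
      by (rule word_eq_append_left)
    moreover have "word_eq relators ([neg g] @ pos g # normal_word (lmul (neg g) p)) (normal_word (lmul (neg g) p))"
      using word_eq.cancel[of relators "[]" g False] by simp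
    ultimately show ?thesis
      using False l by (auto simp: word_class_eq_iff intro: word_eq.trans)
  qed
qed

definition word_value :: "gen word \<Rightarrow> gamma" where
  "word_value w = lmul_word w gamma_one"

lemma word_eq_normal_word: "word_eq relators w (normal_word (word_value w))"
proof (induction w)
  case Nil
  then show ?case by (simp add: word_value_def lmul_word_def word_eq.refl)
next
  case (Cons l w)
  have "word_eq relators (l # w) (l # normal_word (word_value w))"
    using word_eq_append_left[OF Cons, of "[l]"] by simp
  then show ?case
    using word_class_lmul[of l "word_value w"]
    by (auto simp: word_class_eq_iff word_value_def lmul_word_def intro: word_eq.trans)
qed

text \<open>Left to right is completeness, through the common normal form; right to left is
  soundness.\<close>

lemma word_value_eq_iff: "word_value v = word_value w \<longleftrightarrow> word_eq relators v w"
proof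
  assume "word_value v = word_value w"
  then show "word_eq relators v w"
    using word_eq_normal_word[of v] word_eq_normal_word[of w]
    by (auto intro: word_eq.trans word_eq.sym)
qed (auto simp: word_value_def dest: lmul_word_cong)

lemma word_value_append: "word_value (v @ w) = gamma_mult (word_value v) (word_value w)"
  using lmul_word_cong[OF word_eq_normal_word[of v]]
  by (simp add: gamma_mult_def word_value_def) (simp add: lmul_word_def)

definition gamma_of :: "gen word set \<Rightarrow> gamma" where
  "gamma_of S = word_value (SOME w. w \<in> S)"

lemma gamma_of_word_class: "gamma_of (word_class relators w) = word_value w"
proof -
  have "(SOME v. v \<in> word_class relators w) \<in> word_class relators w"
    by (rule someI[of _ w]) (simp add: word_class_def word_eq.refl)
  then show ?thesis
    by (simp add: gamma_of_def word_value_eq_iff word_class_def)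
qed

lemma gamma_of_mult:
  assumes "S \<in> carrier Gamma7a1" "T \<in> carrier Gamma7a1"
  shows "gamma_of (S \<otimes>\<^bsub>Gamma7a1\<^esub> T) = gamma_mult (gamma_of S) (gamma_of T)"
  using assms
  by (auto simp: Gamma7a1_eq carrier_presented_group mult_presented_group
      gamma_of_word_class word_value_append)

lemma bij_betw_gamma_of: "bij_betw gamma_of (carrier Gamma7a1) UNIV"
proof -
  have "p \<in> gamma_of ` carrier Gamma7a1" for p
    by (rule image_eqI[of _ _ "word_class relators (normal_word p)"])
      (simp_all add: Gamma7a1_eq carrier_presented_group gamma_of_word_class
        word_value_def lmul_word_normal_word)
  then show ?thesis
    by (auto simp: bij_betw_def inj_on_def Gamma7a1_eq carrier_presented_group
        gamma_of_word_class word_value_eq_iff word_class_eq_iff)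
qed

lemma gamma_of_commute:
  assumes "S \<in> carrier Gamma7a1" "T \<in> carrier Gamma7a1"
  shows "S \<otimes>\<^bsub>Gamma7a1\<^esub> T = T \<otimes>\<^bsub>Gamma7a1\<^esub> S \<longleftrightarrow> gamma_rel (gamma_of S) (gamma_of T)"
proof -
  interpret group Gamma7a1
    by (simp add: Gamma7a1_eq group_presented_group)
  show ?thesis
    using assms inj_on_eq_iff[OF bij_betw_imp_inj_on[OF bij_betw_gamma_of],
        of "S \<otimes>\<^bsub>Gamma7a1\<^esub> T" "T \<otimes>\<^bsub>Gamma7a1\<^esub> S"]
    by (simp add: gamma_of_mult)
qed

text \<open>The centre is generated by \<open>\<beta>\<^sub>1\<close>, so passing to the quotient drops the first component.\<close>

type_synonym gamma_quot = "bool \<times> bool \<times> bool \<times> bool"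

text \<open>The conditions express agreement of the \<open>Beta2\<close> and \<open>Beta1\<close>
  exponents of the two products in \<open>gamma_mult_eq\<close>; the other exponents always
  agree.\<close>

fun quot_rel :: "gamma_quot \<Rightarrow> gamma_quot \<Rightarrow> bool" where
  "quot_rel (y, z, i, j) (y', z', i', j') \<longleftrightarrow>
     (j \<and> z' \<longleftrightarrow> j' \<and> z) \<and> (((j \<and> y') \<noteq> (i \<and> z')) \<longleftrightarrow> ((j' \<and> y) \<noteq> (i' \<and> z)))"

section \<open>The product in coordinates\<close>

lemma lmul_word_append: "lmul_word (v @ w) p = lmul_word v (lmul_word w p)"
  by (simp add: lmul_word_def)

text \<open>Each block of a normal word acts by polynomials over the field with two elements in its
  exponent \<open>b\<close>, which avoids a case split over all pairs of tuples.\<close>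

lemma lmul_word_if:
  "lmul_word (if b then [pos Beta1] else []) (x, y, z, i, j) = (b \<noteq> x, y, z, i, j)"
  "lmul_word (if b then [pos Beta2] else []) (x, y, z, i, j) = (x, b \<noteq> y, z, i, j)"
  "lmul_word (if b then [pos Beta3] else []) (x, y, z, i, j) = (x, y, b \<noteq> z, i, j)"
  "lmul_word (if b then [pos Alpha] else []) (x, y, z, i, j) =
     (x \<noteq> (b \<and> y), y \<noteq> (b \<and> z), z, i \<noteq> (b \<and> j), b \<noteq> j)"
  "lmul_word (if b then [pos Alpha, pos Alpha] else []) (x, y, z, i, j) =
     (x \<noteq> (b \<and> z), y, z, b \<noteq> i, j)"
  by (cases b; auto simp: lmul_word_def)+

lemma gamma_mult_eq:
  "gamma_mult (x, y, z, i, j) (x', y', z', i', j') =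
     (x \<noteq> ((x' \<noteq> (j \<and> y')) \<noteq> (i \<and> z')), y \<noteq> (y' \<noteq> (j \<and> z')), z \<noteq> z',
      i \<noteq> (i' \<noteq> (j \<and> j')), j \<noteq> j')"
  unfolding gamma_mult_def normal_word.simps lmul_word_append lmul_word_if ..

text \<open>Removes the symmetric part of the products, leaving the bilinear terms to
  compare.\<close>

lemma xor_cancel:
  "(a \<noteq> (b \<noteq> s)) = (b \<noteq> (a \<noteq> t)) \<longleftrightarrow> s = t"
  "(a \<noteq> ((b \<noteq> s) \<noteq> s')) = (b \<noteq> ((a \<noteq> t) \<noteq> t')) \<longleftrightarrow> (s \<noteq> s') = (t \<noteq> t')"
  for a b s t s' t' :: bool
  by (cases a; cases b; auto)+

lemma gamma_rel_iff: "gamma_rel p q \<longleftrightarrow> quot_rel (snd p) (snd q)"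
proof -
  obtain x y z i j where p: "p = (x, y, z, i, j)" by (metis surj_pair)
  obtain x' y' z' i' j' where q: "q = (x', y', z', i', j')" by (metis surj_pair)
  show ?thesis
    unfolding p q gamma_mult_eq prod.inject xor_cancel snd_conv quot_rel.simps by blast
qed

lemma k_to_one_on_snd_gamma: "k_to_one_on 2 (snd :: gamma \<Rightarrow> gamma_quot) UNIV UNIV"
proof -
  have "card {p :: gamma. snd p = t} = 2" for t :: gamma_quot
  proof -
    have "{p :: gamma. snd p = t} = UNIV \<times> {t}"
      by auto
    then show ?thesis
      by (simp only: card_cartesian_product) simp
  qed
  then show ?thesis
    by (simp add: k_to_one_on_def del: split_paired_All)
qed

section \<open>Counting in the central quotient with 16 elements\<close>

lemma card_bool4:
  "card {q::gamma_quot. P q} =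
     (\<Sum>y\<in>UNIV. \<Sum>z\<in>UNIV. \<Sum>i\<in>UNIV. \<Sum>j\<in>UNIV. of_bool (P (y, z, i, j)))"
proof -
  have "card {q. P q} = (\<Sum>q\<in>UNIV. of_bool (P q))"
    by simp
  then show ?thesis
    by (simp only: sum.cartesian_product UNIV_Times_UNIV) (simp add: case_prod_unfold)
qed

lemma sum_gamma_quot:
  "(\<Sum>q\<in>UNIV. f (q :: gamma_quot)) =
     (\<Sum>y\<in>UNIV. \<Sum>z\<in>UNIV. \<Sum>i\<in>UNIV. \<Sum>j\<in>UNIV. f (y, z, i, j))"
  by (simp only: sum.cartesian_product UNIV_Times_UNIV) (simp add: case_prod_unfold)

text \<open>The terms come from the identity, the three other elements with \<open>z\<close> and
  \<open>j\<close> false, and the twelve with \<open>z \<or> j\<close>.\<close>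

lemma star_count_quot_rel: "star_count quot_rel n UNIV = 16 ^ n + 3 * 8 ^ n + 12 * 4 ^ n"
  by (simp add: star_count_def sum_gamma_quot card_bool4 UNIV_bool) (simp add: numeral_eq_Suc)

lemma quot_rel_refl: "quot_rel (False, False, False, False) q" "quot_rel p p"
  by (cases q, simp) (cases p, simp)

lemma quot_rel_sym: "quot_rel p q \<Longrightarrow> quot_rel q p"
  by (cases p; cases q) auto

lemma card_centraliser_index4:
  assumes "z \<or> j"
  shows "card {q. quot_rel (y, z, i, j) q} = 4"
  using assms by (cases z; cases j; cases y; cases i) (simp_all add: card_bool4 UNIV_bool)

text \<open>If \<open>z\<close> holds, the equations give \<open>j'\<close> and \<open>i'\<close>
  linearly in \<open>y'\<close> and \<open>z'\<close>; if only \<open>j\<close> holds, they give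
  \<open>z'\<close> and \<open>y'\<close> in terms of \<open>j'\<close>. Both forms vanish on the
  resulting plane.\<close>

lemma centraliser_index4_clique:
  assumes "z \<or> j" "quot_rel (y, z, i, j) q" "quot_rel (y, z, i, j) r"
  shows "quot_rel q r"
proof -
  obtain y1 z1 i1 j1 where q: "q = (y1, z1, i1, j1)" by (metis surj_pair)
  obtain y2 z2 i2 j2 where r: "r = (y2, z2, i2, j2)" by (metis surj_pair)
  show ?thesis
    using assms unfolding q r by (cases z; cases j; cases y; cases i) auto
qed

text \<open>With \<open>z\<close> and \<open>j\<close> false, commuting is the single nonzero linear
  condition \<open>i \<and> z' \<longleftrightarrow> y \<and> j'\<close>, met by half of the 16
  elements.\<close>

lemma card_centraliser_index2:
  assumes "y \<or> i"
  shows "card {q. quot_rel (y, False, i, False) q} = 8"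
  using assms by (cases y; cases i) (simp_all add: card_bool4 UNIV_bool)

text \<open>On the 8-element centraliser the two forms reduce to one alternating form whose radical
  is the identity and \<open>(y, False, i, False)\<close>; any other \<open>q\<close> imposes one
  more linear condition.\<close>

lemma card_centraliser_pair:
  assumes "y \<or> i" "quot_rel (y, False, i, False) q" "q \<noteq> (False, False, False, False)"
    and "q \<noteq> (y, False, i, False)"
  shows "card {r. quot_rel (y, False, i, False) r \<and> quot_rel q r} = 4"
proof -
  obtain y1 z1 i1 j1 where q: "q = (y1, z1, i1, j1)" by (metis surj_pair)
  show ?thesis
    using assms unfolding q
    by (cases y; cases i; cases z1; cases j1; cases y1; cases i1) (simp_all add: card_bool4 UNIV_bool)
qed

text \<open>The common centraliser is spanned by the radical and \<open>q\<close>, and the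
  alternating form vanishes on it.\<close>

lemma centraliser_pair_clique:
  assumes "y \<or> i" "quot_rel (y, False, i, False) q" "q \<noteq> (False, False, False, False)"
    and "q \<noteq> (y, False, i, False)"
    and "quot_rel (y, False, i, False) r" "quot_rel (y, False, i, False) s"
    and "quot_rel q r" "quot_rel q s"
  shows "quot_rel r s"
proof -
  obtain y1 z1 i1 j1 where q: "q = (y1, z1, i1, j1)" by (metis surj_pair)
  obtain y2 z2 i2 j2 where r: "r = (y2, z2, i2, j2)" by (metis surj_pair)
  obtain y3 z3 i3 j3 where s: "s = (y3, z3, i3, j3)" by (metis surj_pair)
  show ?thesis
    using assms unfolding q r s
    by (cases y; cases i; cases z1; cases j1; cases y1; cases i1) auto
qed

text \<open>Solves \<open>c (n + 1) = 2 * c n + 6 * 4 ^ n\<close> with \<open>c 0 = 1\<close>: a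
  first entry is one of two radical elements or one of six whose neighbours form a clique of size
  4.\<close>

lemma clique_count_centraliser_index2:
  assumes "y \<or> i"
  shows "int (clique_count quot_rel n {q. quot_rel (y, False, i, False) q}) = 3 * 4 ^ n - 2 * 2 ^ n"
proof (induction n)
  case (Suc n)
  define p where "p = (y, False, i, False)"
  define e where "e = (False, False, False, False)"
  have rel: "quot_rel e q" "quot_rel q e" "quot_rel q q" for q
    unfolding e_def using quot_rel_refl quot_rel_sym by blast+
  have "e \<noteq> p"
    using assms by (auto simp: e_def p_def)
  let ?S = "{q. quot_rel p q}"
  have "clique_count quot_rel (Suc n) ?S =
      card {e, p} * clique_count quot_rel n ?S + (\<Sum>q\<in>?S - {e, p}. 4 ^ n)"
  proof (rule clique_count_Suc_split)
    fix q assume q: "q \<in> ?S - {e, p}"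
    have "clique_count quot_rel n {r \<in> ?S. quot_rel q r} = card {r \<in> ?S. quot_rel q r} ^ n"
      by (rule clique_count_of_clique)
        (use centraliser_pair_clique[OF assms, of q, folded p_def e_def] q in blast)
    then show "clique_count quot_rel n {r \<in> ?S. quot_rel q r} = 4 ^ n"
      using card_centraliser_pair[OF assms, of q, folded p_def e_def] q by simp
  qed (use rel in auto)
  moreover have "card (?S - {e, p}) = 6"
    using card_centraliser_index2[OF assms, folded p_def] \<open>e \<noteq> p\<close> rel
    by (subst card_Diff_subset) auto
  ultimately show ?case
    using Suc \<open>e \<noteq> p\<close> unfolding p_def[symmetric] by simp
qed simp

text \<open>Sorting first entries by centraliser gives
  \<open>c (n + 1) = c n + 3 * (3 * 4 ^ n - 2 * 2 ^ n) + 12 * 4 ^ n\<close>, from the identity, the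
  index 2 and the index 4 elements.\<close>

lemma clique_count_quot_rel: "int (clique_count quot_rel n UNIV) = 7 * 4 ^ n - 6 * 2 ^ n"
proof (induction n)
  case (Suc n)
  have index4: "clique_count quot_rel n {q. quot_rel (y, z, i, j) q} = 4 ^ n" if "z \<or> j" for y z i j
  proof -
    have "clique_count quot_rel n {q. quot_rel (y, z, i, j) q} = card {q. quot_rel (y, z, i, j) q} ^ n"
      by (rule clique_count_of_clique) (use centraliser_index4_clique[OF that] in blast)
    then show ?thesis
      by (simp only: card_centraliser_index4[OF that])
  qed
  define f where "f p = clique_count quot_rel n {q. quot_rel p q}" for p
  have f: "int (f (y, z, i, j)) =
      (if z \<or> j then 4 ^ n else if y \<or> i then 3 * 4 ^ n - 2 * 2 ^ n else 7 * 4 ^ n - 6 * 2 ^ n)" for y z i j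
    using index4[of z j y i] clique_count_centraliser_index2[of y i n] Suc
    by (cases "z \<or> j"; cases "y \<or> i") (auto simp: f_def quot_rel_refl simp del: quot_rel.simps)
  have "clique_count quot_rel (Suc n) UNIV = (\<Sum>p\<in>UNIV. f p)"
    by (simp add: f_def)
  then show ?case
    by (simp add: sum_gamma_quot UNIV_bool f del: clique_count.simps)
qed simp

section \<open>The generating functions\<close>

lemma group_Gamma7a1: "group Gamma7a1"
  by (simp add: Gamma7a1_eq group_presented_group)

lemma finite_Gamma7a1: "finite (carrier Gamma7a1)"
  using bij_betw_finite[OF bij_betw_gamma_of] by simp

lemma order_Gamma7a1: "order Gamma7a1 = 32"
  using bij_betw_same_card[OF bij_betw_gamma_of]
  by (simp add: order_def card_cartesian_product flip: UNIV_Times_UNIV)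

lemma star_count_Gamma7a1:
  "star_count (commutes Gamma7a1) n (carrier Gamma7a1) = 2 ^ Suc n * (16 ^ n + 3 * 8 ^ n + 12 * 4 ^ n)"
  using star_count_k_to_one[OF bij_betw_imp_k_to_one_on[OF bij_betw_gamma_of finite_Gamma7a1],
      of "commutes Gamma7a1" gamma_rel n]
    star_count_k_to_one[OF k_to_one_on_snd_gamma, of gamma_rel quot_rel n]
    gamma_of_commute
  by (simp add: commutes_def gamma_rel_iff star_count_quot_rel)

lemma clique_count_Gamma7a1:
  "int (clique_count (commutes Gamma7a1) n (carrier Gamma7a1)) = 2 ^ n * (7 * 4 ^ n - 6 * 2 ^ n)"
  using clique_count_k_to_one[OF bij_betw_imp_k_to_one_on[OF bij_betw_gamma_of finite_Gamma7a1],
      of "commutes Gamma7a1" gamma_rel n]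
    clique_count_k_to_one[OF k_to_one_on_snd_gamma, of gamma_rel quot_rel n]
    gamma_of_commute clique_count_quot_rel[of n]
  by (simp add: commutes_def gamma_rel_iff)

section \<open>Coefficients of the generating functions\<close>

lemma fps_const_divide_linear:
  fixes a c :: "'a::field"
  shows "fps_const a / (1 - fps_const c * fps_X) = Abs_fps (\<lambda>n. a * c ^ n)"
proof -
  have "Abs_fps (\<lambda>n. a * c ^ n) * (1 - fps_const c * fps_X) = fps_const a"
  proof (rule fps_ext)
    fix n
    show "fps_nth (Abs_fps (\<lambda>n. a * c ^ n) * (1 - fps_const c * fps_X)) n = fps_nth (fps_const a) n"
      by (cases n) (simp_all add: algebra_simps)
  qed
  moreover have "1 - fps_const c * fps_X \<noteq> 0"
    by (auto dest: arg_cong[where f = "\<lambda>f. fps_nth f 0"])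
  ultimately show ?thesis
    by (metis nonzero_mult_div_cancel_right)
qed

lemma fps_compose_linear_nth:
  fixes f :: "'a::comm_ring_1 fps"
  shows "fps_nth (f oo (fps_const c * fps_X)) n = fps_nth f n * c ^ n"
proof -
  \<comment> \<open>Powers of \<open>fps_const c * fps_X\<close> are monomials, so only
    \<open>i = n\<close> contributes.\<close>
  have "fps_nth (f oo (fps_const c * fps_X)) n = (\<Sum>i=0..n. if i = n then fps_nth f n * c ^ n else 0)"
    unfolding fps_compose_nth
    by (intro sum.cong) (auto simp: power_mult_distrib fps_const_power)
  then show ?thesis
    by simp
qed

lemma alpha_density:
  assumes "in_Gamma7 G" "finite (carrier G)"
  shows "of_nat (alpha G n) * (1 / of_nat (order G)) ^ n =
    (3 / 4 * (1 / 4) ^ n + 3 / 16 * (1 / 2) ^ n + 1 / 16 :: rat)"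
proof -
  have "group G" "isoclinic G Gamma7a1"
    using assms(1) by (auto simp: in_Gamma7_def)
  interpret group G by fact
  have pos: "order G > 0"
    using assms(2) by (simp add: order_gt_0_iff_finite)
  have "alpha G n * order G * 32 ^ Suc n = 2 ^ Suc n * (16 ^ n + 3 * 8 ^ n + 12 * 4 ^ n) * order G ^ Suc n"
    using isoclinic_count_transfer(1)[OF \<open>group G\<close> group_Gamma7a1
        assms(2) finite_Gamma7a1 \<open>isoclinic G Gamma7a1\<close>, of n]
    by (simp only: alpha_eq_star_count[OF assms(2)] order_Gamma7a1 star_count_Gamma7a1)
  then have "alpha G n * 32 ^ Suc n = 2 ^ Suc n * (16 ^ n + 3 * 8 ^ n + 12 * 4 ^ n) * order G ^ n"
    using pos by simp
  then have "(of_nat (alpha G n) * 32 ^ Suc n :: rat) =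
      2 ^ Suc n * (16 ^ n + 3 * 8 ^ n + 12 * 4 ^ n) * of_nat (order G) ^ n"
    by (metis (mono_tags, lifting) of_nat_add of_nat_mult of_nat_numeral of_nat_power)
  then have "of_nat (alpha G n) / of_nat (order G) ^ n =
      (2 ^ Suc n * (16 ^ n + 3 * 8 ^ n + 12 * 4 ^ n) / 32 ^ Suc n :: rat)"
    using pos by (simp add: field_simps)
  \<comment> \<open>One factor \<open>2 / 32\<close> is pulled out; the remaining bases are the
    centraliser proportions 1, 1/2 and 1/4.\<close>
  also have "\<dots> = 1 / 16 * ((2 * 16 / 32) ^ n + 3 * (2 * 8 / 32) ^ n + 12 * (2 * 4 / 32) ^ n)"
    unfolding power_divide power_mult_distrib by (simp add: field_simps)
  also have "\<dots> = 3 / 4 * (1 / 4) ^ n + 3 / 16 * (1 / 2) ^ n + 1 / 16"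
    by (simp add: field_simps)
  finally show ?thesis
    by (simp only: divide_inverse mult_1_left power_inverse)
qed

lemma beta_density:
  assumes "in_Gamma7 G" "finite (carrier G)"
  shows "of_nat (beta G n) * (1 / of_nat (order G)) ^ n =
    (7 / 4 * (1 / 4) ^ n - 3 / 4 * (1 / 8) ^ n :: rat)"
proof -
  have "group G" "isoclinic G Gamma7a1"
    using assms(1) by (auto simp: in_Gamma7_def)
  interpret group G by fact
  have pos: "order G > 0"
    using assms(2) by (simp add: order_gt_0_iff_finite)
  have "beta G n * order G * 32 ^ Suc n =
      clique_count (commutes Gamma7a1) (Suc n) (carrier Gamma7a1) * order G ^ Suc n"
    using isoclinic_count_transfer(2)[OF \<open>group G\<close> group_Gamma7a1
        assms(2) finite_Gamma7a1 \<open>isoclinic G Gamma7a1\<close>, of "Suc n"]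
    by (simp only: beta_eq_clique_count[OF assms(2)] order_Gamma7a1)
  then have "beta G n * 32 ^ Suc n =
      clique_count (commutes Gamma7a1) (Suc n) (carrier Gamma7a1) * order G ^ n"
    using pos by (simp del: clique_count.simps)
  \<comment> \<open>The detour through integers keeps the subtraction in the clique count
    exact.\<close>
  then have "(of_nat (beta G n) * 32 ^ Suc n :: rat) =
      of_int (int (clique_count (commutes Gamma7a1) (Suc n) (carrier Gamma7a1))) * of_nat (order G) ^ n"
    by (metis (mono_tags, lifting) of_nat_mult of_nat_numeral of_nat_power of_int_of_nat_eq)
  then have "(of_nat (beta G n) * 32 ^ Suc n :: rat) =
      2 ^ Suc n * (7 * 4 ^ Suc n - 6 * 2 ^ Suc n) * of_nat (order G) ^ n"
    unfolding clique_count_Gamma7a1 by simp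
  then have "of_nat (beta G n) / of_nat (order G) ^ n =
      (2 ^ Suc n * (7 * 4 ^ Suc n - 6 * 2 ^ Suc n) / 32 ^ Suc n :: rat)"
    using pos by (simp add: field_simps)
  \<comment> \<open>The extra entry accounts for \<open>7 / 4 = 7 * (8 / 32)\<close> and
    \<open>3 / 4 = 6 * (4 / 32)\<close>.\<close>
  also have "\<dots> = 7 / 4 * (2 * 4 / 32) ^ n - 3 / 4 * (2 * 2 / 32) ^ n"
    unfolding power_divide power_mult_distrib by (simp add: field_simps)
  also have "\<dots> = 7 / 4 * (1 / 4) ^ n - 3 / 4 * (1 / 8) ^ n"
    by (simp add: field_simps)
  finally show ?thesis
    by (simp only: divide_inverse mult_1_left power_inverse)
qed

theorem lemma5p17:
  fixes G :: "('a, 'b) monoid_scheme" and m :: nat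
  assumes "group G"
    and "order G = 2 ^ m"
    and "isoclinism_rank G = 5"
    and "in_Gamma7 G"
  shows "(A_series G oo (fps_const (1 / of_nat (order G)) * fps_X) =
           fps_const (1 - 1 / 2 ^ 2) / (1 - fps_const (1 / 2 ^ 2) * fps_X)
         + fps_const (1 / 2 ^ 2 - 1 / 2 ^ 4) / (1 - fps_const (1 / 2) * fps_X)
         + fps_const (1 / 2 ^ 4) / (1 - fps_X))
    \<and> (B_series G oo (fps_const (1 / of_nat (order G)) * fps_X) =
           fps_const (- (1 / 2) - 1 / 2 ^ 2) / (1 - fps_const (1 / 2 ^ 3) * fps_X)
         + fps_const (1 + 1 / 2 + 1 / 2 ^ 2) / (1 - fps_const (1 / 2 ^ 2) * fps_X))"
proof -
  \<comment> \<open>An infinite carrier would have order 0, which is no power of 2.\<close>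
  have fin: "finite (carrier G)"
    using assms(2) by (metis card.infinite order_def power_not_zero zero_neq_numeral)
  \<comment> \<open>The geometric series of ratio 1, whose denominator carries no explicit
    \<open>fps_const\<close> factor.\<close>
  have X: "fps_const a / (1 - fps_X) = Abs_fps (\<lambda>n. a)" for a :: rat
    using fps_const_divide_linear[of a 1] by simp
  \<comment> \<open>Coefficients are compared; the constants simplify to 3/4, 3/16, 1/16 and to
    -3/4, 7/4.\<close>
  show ?thesis
    unfolding fps_const_divide_linear X fps_eq_iff fps_compose_linear_nth A_series_def B_series_def
      fps_add_nth fps_nth_Abs_fps alpha_density[OF assms(4) fin] beta_density[OF assms(4) fin]
    by simp
qed

end
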